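(* Let $0<\varepsilon<1$ and $c>0$ be reals. Let $G$ be an $n$-vertex graph with at least $cn^{1+\varepsilon}$ edges. Then there is a $6$-almost-regular subgraph $H$ of $G$ on some number $m$ of vertices such that \[e(H)\geq \frac{2^\varepsilon-1}{48}\,c\, m^{1+\varepsilon}\quad\text{and}\quad d(H)\geq \frac{1}{12}\cdot\frac{d(G)}{\log (2n/d(G))}.\]
   Context: For a real $\mu\geq 1$, a graph $H$ is $\mu$-almost-regular if $\Delta(H)\leq \mu\,\delta(H)$, where $\Delta,\delta$ denote maximum and minimum degree. $d(G)$ denotes the average degree of $G$ and $e(G)$ its number of edges. Here $\log$ denotes the logarithm to base $2$. *)

theory Defs
  imports Complex_Main
begin

text \<open>Graphs are finite, simple and undirected with a nonempty vertex set; a graph is given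
  by its vertex set and its set of two-element edges.\<close>

definition simple_graph :: "'a set \<Rightarrow> 'a set set \<Rightarrow> bool" where
  "simple_graph V E \<longleftrightarrow> finite V \<and> V \<noteq> {} \<and> (\<forall>e\<in>E. e \<subseteq> V \<and> card e = 2)"

definition is_subgraph :: "'a set \<Rightarrow> 'a set set \<Rightarrow> 'a set \<Rightarrow> 'a set set \<Rightarrow> bool" where
  "is_subgraph W F V E \<longleftrightarrow> simple_graph W F \<and> W \<subseteq> V \<and> F \<subseteq> E"

definition degree :: "'a set set \<Rightarrow> 'a \<Rightarrow> nat" where
  "degree E v = card {e \<in> E. v \<in> e}"

definition max_degree :: "'a set \<Rightarrow> 'a set set \<Rightarrow> nat" where
  "max_degree V E = Max (degree E ` V)"

definition min_degree :: "'a set \<Rightarrow> 'a set set \<Rightarrow> nat" where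
  "min_degree V E = Min (degree E ` V)"

definition avg_degree :: "'a set \<Rightarrow> 'a set set \<Rightarrow> real" where
  "avg_degree V E = (\<Sum>v\<in>V. real (degree E v)) / real (card V)"

definition almost_regular :: "real \<Rightarrow> 'a set \<Rightarrow> 'a set set \<Rightarrow> bool" where
  "almost_regular \<mu> V E \<longleftrightarrow> real (max_degree V E) \<le> \<mu> * real (min_degree V E)"

end

theory Submission
  imports Defs
begin

text \<open>
  Write \<open>D = d(G)/4\<close> and \<open>L = log (2n/d(G))\<close>. If \<open>L < 5/2\<close>, then a subgraph of minimum degree at least
  \<open>d(G)/2 \<ge> n/6\<close> does the job. Otherwise, a maximum cut of such a subgraph has a larger side \<open>A\<close>
  all of whose vertices have at least \<open>D\<close> neighbours across. Following Pyber, take a minimal \<open>X \<subseteq> A\<close>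
  with \<open>|N(X)| \<le> |X|\<close>; by Hall's theorem it is perfectly matched to \<open>N(X)\<close>. Deleting that matching and
  iterating inside \<open>X\<close> yields \<open>\<delta> = \<lceil>D\<rceil>\<close> disjoint matchings on nested vertex sets, the \<open>t\<close>-th
  of size \<open>s t\<close> with \<open>\<delta> - t \<le> s t \<le> n/2\<close>.

  The union of the \<open>k\<close> consecutive matchings from index \<open>i\<close> on has maximum degree at most \<open>k\<close>, and its
  average degree is the sum of their sizes divided by \<open>s i\<close>. To find a window in which the sizes
  decay slowly, choose \<open>i\<close> minimising \<open>i + \<Phi> (s i)\<close> for a potential \<open>\<Phi>\<close> combining a logarithm
  with a multiple of the \<open>\<epsilon>\<close>-th power: minimality says that beyond \<open>i\<close> the sizes halve at most once in
  \<open>\<tau>\<close> steps, where \<open>\<tau>\<close> is the required average degree, so that \<open>\<lfloor>2\<tau>\<rfloor>\<close> steps suffice. Finally, pass to a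
  subgraph whose minimum degree is at least half the average degree.
\<close>

subsection \<open>Windows of slow decay\<close>

text \<open>The tangent to \<open>exp\<close> at \<open>w * u\<close> lies below \<open>exp\<close>
  at both \<open>0\<close> and \<open>u\<close>; averaging with weights \<open>1 - w\<close> and
  \<open>w\<close> cancels the linear terms.\<close>

lemma exp_le_chord:
  fixes u w :: real
  assumes "0 \<le> w" "w \<le> 1"
  shows "exp (w * u) \<le> 1 - w + w * exp u"
proof -
  define p where "p = exp (w * u)"
  have *: "p * (1 + (x - w * u)) \<le> exp x" for x
  proof -
    have "p * (1 + (x - w * u)) \<le> p * exp (x - w * u)"
      unfolding p_def by (intro mult_left_mono exp_ge_add_one_self) simp
    then show ?thesis by (simp add: p_def flip: exp_add)
  qed
  have "(1 - w) * (p * (1 + (0 - w * u))) + w * (p * (1 + (u - w * u))) \<le> (1 - w) * exp 0 + w * exp u"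
    using assms by (intro add_mono mult_left_mono *) auto
  then show ?thesis by (simp add: p_def algebra_simps)
qed

lemma powr_le_chord:
  fixes x w :: real
  assumes "0 < x" "0 \<le> w" "w \<le> 1"
  shows "x powr w \<le> 1 - w + w * x"
  using exp_le_chord[OF assms(2,3), of "ln x"] assms(1) by (simp add: powr_def)

text \<open>Convexity reduces the sum to \<open>k\<close> times its value at the mean exponent.
  Rounding \<open>2 * \<tau>\<close> down makes \<open>k\<close> smaller but also lowers that
  exponent, and the second effect makes up for the first.\<close>

lemma sum_ge_of_halving:
  fixes x :: "nat \<Rightarrow> real" and \<tau> :: real
  assumes "1 \<le> \<tau>" and k: "k = nat \<lfloor>2 * \<tau>\<rfloor>"
    and x: "\<And>j. j < k \<Longrightarrow> 2 powr (- real j / \<tau>) \<le> x j"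
  shows "\<tau> \<le> (\<Sum>j<k. x j)"
proof -
  have k_bounds: "real k \<le> 2 * \<tau>" "2 * \<tau> - 1 < real k"
    using assms(1) unfolding k by linarith+
  \<comment> \<open>The mean of \<open>real j / \<tau>\<close> over \<open>j < k\<close>.\<close>
  define m where "m = (real k - 1) / (2 * \<tau>)"
  \<comment> \<open>Jensen: the tangent at the mean exponent \<open>m\<close> bounds the convex summands from below.\<close>
  have tangent: "2 powr (-m) * (1 + ln 2 * (m - real j / \<tau>)) \<le> 2 powr (- real j / \<tau>)" for j
  proof -
    have "1 + ln 2 * (m - real j / \<tau>) \<le> exp (ln 2 * (m - real j / \<tau>))"
      by (rule exp_ge_add_one_self)
    then have "2 powr (-m) * (1 + ln 2 * (m - real j / \<tau>)) \<le> 2 powr (-m) * 2 powr (m - real j / \<tau>)"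
      by (intro mult_left_mono) (simp_all add: powr_def mult.commute)
    then show ?thesis by (simp flip: powr_add)
  qed
  have sumj: "(\<Sum>j<k. real j) = real k * (real k - 1) / 2"
    by (induction k) (auto simp: field_simps)
  have "(\<Sum>j<k. m - real j / \<tau>) = real k * m - (\<Sum>j<k. real j) / \<tau>"
    by (simp add: sum_subtractf sum_divide_distrib)
  also have "\<dots> = 0" unfolding sumj m_def by simp
  finally have zero: "(\<Sum>j<k. m - real j / \<tau>) = 0" .
  have "2 powr (-m) * real k = 2 powr (-m) * (real k + ln 2 * (\<Sum>j<k. m - real j / \<tau>))"
    unfolding zero by simp
  also have "\<dots> = (\<Sum>j<k. 2 powr (-m) * (1 + ln 2 * (m - real j / \<tau>)))"
    by (simp only: sum_distrib_left[symmetric] sum.distrib) simp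
  also have "\<dots> \<le> (\<Sum>j<k. x j)"
    using tangent x by (intro sum_mono) (meson lessThan_iff order_trans)
  finally have 1: "2 powr (-m) * real k \<le> (\<Sum>j<k. x j)" .
  define y where "y = real k / (2 * \<tau>)"
  have y: "1/2 \<le> y" "y \<le> 1" "real k = 2 * \<tau> * y"
    using k_bounds assms(1) unfolding y_def by (auto simp: field_simps)
  \<comment> \<open>As \<open>y\<close> falls from 1 to 1/2, \<open>w\<close> runs from 0 to 1, and
    the chord of \<open>(1/2) powr w\<close> over that range is exactly \<open>y\<close>.\<close>
  define w where "w = 2 * (1 - y)"
  have "2 powr (-w) = (1/2) powr w"
    by (simp add: powr_minus powr_divide inverse_eq_divide)
  also have "\<dots> \<le> y"
    using powr_le_chord[of "1/2" w] y by (simp add: w_def diff_divide_distrib)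
  finally have chord: "2 powr (-w) \<le> y" .
  have "m = y - 1 / (2*\<tau>)" unfolding m_def y_def by (simp add: diff_divide_distrib)
  \<comment> \<open>Rounding down loses less than 1, so \<open>k + 1\<close> is at least
    \<open>2 * \<tau>\<close>; this is what makes \<open>m + w \<le> 1\<close>.\<close>
  moreover have "1 \<le> y + 1 / (2*\<tau>)"
    using k_bounds assms(1) unfolding y_def by (simp add: field_simps)
  ultimately have "-1 \<le> -m + -w" unfolding w_def by argo
  then have "(2::real) powr (-1) \<le> 2 powr (-m + -w)" by (intro powr_mono) auto
  then have "2 * \<tau> * 2 powr (-1) \<le> 2 * \<tau> * 2 powr (-m + -w)"
    using assms(1) by (intro mult_left_mono) auto
  then have "\<tau> \<le> 2 * \<tau> * 2 powr (-m + -w)" by (simp add: powr_minus)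
  also have "\<dots> = 2 * \<tau> * (2 powr (-m) * 2 powr (-w))" by (simp only: powr_add)
  also have "\<dots> \<le> 2 * \<tau> * (2 powr (-m) * y)"
    using chord assms(1) by (intro mult_left_mono) auto
  also have "\<dots> = 2 powr (-m) * real k" using y(3) by simp
  finally show ?thesis using 1 by linarith
qed

text \<open>With \<open>v\<close> the number of halvings from \<open>s\<close> to \<open>s'\<close>,
  the power term drops by a concave function of \<open>v\<close>, hence at least by its chord over
  the two octaves \<open>0 \<le> v \<le> 2\<close>. The equation for \<open>B\<close> makes this
  chord equal to \<open>max 0 (b - a) * (s / N) powr \<epsilon> * v\<close>.\<close>

lemma potential_drop:
  fixes a b B \<epsilon> N s s' :: real
  assumes "0 < \<epsilon>" "0 \<le> a" "0 \<le> b" "0 < s'" "s' \<le> s" "s \<le> 4 * s'" "s \<le> N"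
    and B: "B * (1 - 4 powr (-\<epsilon>)) = 2 * max 0 (b - a)" "0 \<le> B"
  shows "max a (b * (s / N) powr \<epsilon>) * log 2 (s / s')
    \<le> (a * log 2 s + B * (s / N) powr \<epsilon>) - (a * log 2 s' + B * (s' / N) powr \<epsilon>)"
proof -
  define v where "v = log 2 (s / s')"
  define R where "R = (s / N) powr \<epsilon>"
  have s: "s' = s * 2 powr (-v)" using assms by (simp add: v_def powr_minus field_simps)
  have v: "0 \<le> v" "v \<le> 2"
  proof -
    show "0 \<le> v" using assms by (simp add: v_def)
    have "v \<le> log 2 4" unfolding v_def using assms by (subst log_le_cancel_iff) (auto simp: field_simps)
    also have "log 2 (4::real) = 2" using log_pow_cancel[of "2::real" 2] by simp
    finally show "v \<le> 2" .
  qed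
  have R: "0 \<le> R" "R \<le> 1" unfolding R_def using assms by (auto intro!: powr_le1)
  have R': "(s' / N) powr \<epsilon> = R * 2 powr (-\<epsilon> * v)"
  proof -
    have "s' / N = (s / N) * 2 powr (-v)" using s by simp
    then have "(s' / N) powr \<epsilon> = (s / N) powr \<epsilon> * (2 powr (-v)) powr \<epsilon>"
      using assms by (simp only: powr_mult)
    then show ?thesis by (simp add: R_def powr_powr mult.commute)
  qed
  have chord: "2 powr (-\<epsilon> * v) \<le> 1 - v / 2 * (1 - 4 powr (-\<epsilon>))"
  proof -
    have "(4 powr (-\<epsilon>)) powr (v / 2) = 2 powr (-\<epsilon> * v)"
      using powr_powr[of "2::real" 2 "-\<epsilon> * (v / 2)"] by (simp add: powr_powr)
    with powr_le_chord[of "4 powr (-\<epsilon>)" "v / 2"] v show ?thesis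
      by (simp add: algebra_simps)
  qed
  \<comment> \<open>The maximum splits into a constant, paid for by the logarithm, and a multiple of
    \<open>R\<close>, paid for by the power; this uses \<open>R \<le> 1\<close>.\<close>
  have "max a (b * R) \<le> a + max 0 (b - a) * R"
  proof (cases "a \<le> b")
    case True
    have "a * R \<le> a * 1" using R assms by (intro mult_left_mono) auto
    moreover have "0 \<le> (b - a) * R" using R True by simp
    ultimately show ?thesis using True by (auto simp: algebra_simps max_def)
  next
    case False
    have "b * R \<le> b * 1" using R assms by (intro mult_left_mono) auto
    then show ?thesis using False by (auto simp: max_def)
  qed
  then have "max a (b * R) * v \<le> (a + max 0 (b - a) * R) * v"
    using v by (intro mult_right_mono) auto
  also have "\<dots> = a * v + R * (v / 2 * (B * (1 - 4 powr (-\<epsilon>))))"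
    unfolding B by (simp add: algebra_simps)
  also have "\<dots> = a * v + (R * B) * (v / 2 * (1 - 4 powr (-\<epsilon>)))"
    by simp
  also have "\<dots> \<le> a * v + (R * B) * (1 - 2 powr (-\<epsilon> * v))"
    using R B chord by (intro add_left_mono mult_left_mono) auto
  also have "\<dots> = (a * log 2 s + B * R) - (a * log 2 s' + B * (s' / N) powr \<epsilon>)"
    unfolding R' v_def using assms by (simp add: log_divide algebra_simps)
  finally show ?thesis unfolding R_def v_def .
qed

text \<open>The arithmetic behind the claim \<open>far\<close> in
  \<open>exists_dense_window\<close>, in units of \<open>D\<close>: \<open>1/3\<close> and
  \<open>B\<close> come from the potential at the top size, \<open>x\<close> is the number of
  remaining steps, and the last term is the difference in logarithmic potential between sizes
  \<open>D\<close> and \<open>x * D\<close>.\<close>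

lemma window_fits:
  fixes L B x :: real
  assumes "5/2 \<le> L" "0 \<le> B" "B \<le> 2/9 * max 0 (1 - 4/L)"
    "1/8 \<le> x" "x \<le> 1/8 + 2 * max (1 / (3*L)) (1/12)"
  shows "1/3 + B + x + log 2 (1/x) / (3*L) < 1"
proof -
  define u where "u = 1 / L"
  have u: "0 < u" "u \<le> 2/5" "1 / (3*L) = u/3" "4 / L = 4 * u"
    using assms(1) by (auto simp: u_def field_simps)
  have *: "log 2 (1/x) / (3*L) \<le> C * u / 3" if "log 2 (1/x) \<le> C" for C
    using mult_right_mono[OF that, of "u/3"] u(1) unfolding u_def by simp
  have l8: "log 2 (8::real) = 3" "log 2 (4::real) = 2"
    using log_pow_cancel[of "2::real" 3] log_pow_cancel[of "2::real" 2] by simp_all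
  \<comment> \<open>A larger \<open>x\<close> buys a smaller logarithm. At the extreme
    \<open>u = 2/5\<close> the two cases are bounded by 59/60 and 119/120.\<close>
  show ?thesis
  proof (cases "x \<le> 1/4")
    case True
    have "log 2 (1/x) \<le> log 2 8"
      using assms by (subst log_le_cancel_iff) (auto simp: field_simps)
    with l8 have "log 2 (1/x) / (3*L) \<le> u" using *[of 3] by simp
    with True u assms show ?thesis by (auto simp: max_def split: if_splits)
  next
    case False
    then have "log 2 (1/x) \<le> log 2 4"
      using assms by (subst log_le_cancel_iff) (auto simp: field_simps)
    with l8 have "log 2 (1/x) / (3*L) \<le> 2 * u / 3" using *[of 2] by simp
    with u assms show ?thesis by (auto simp: max_def split: if_splits)
  qed
qed


text \<open>Minimality at \<open>i\<close> bounds the drop of the potential over the next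
  \<open>j\<close> steps by \<open>j\<close>, which gives the slow decay that
  \<open>sum_ge_of_halving\<close> needs. The total potential is small enough against
  \<open>D\<close> that the minimiser leaves room for the whole window.\<close>

lemma exists_dense_window:
  fixes s :: "nat \<Rightarrow> real" and D L \<epsilon> :: real
  assumes "0 < D" "D \<le> real \<delta>" "5/2 \<le> L" "0 < \<epsilon>" "\<epsilon> < 1"
    and mono: "\<And>t t'. t \<le> t' \<Longrightarrow> t' < \<delta> \<Longrightarrow> s t' \<le> s t"
    and low: "\<And>t. t < \<delta> \<Longrightarrow> real (\<delta> - t) \<le> s t"
    and top: "s 0 \<le> D * 2 powr L"
  shows "\<exists>i k. 0 < k \<and> i + k \<le> \<delta> \<and> real k / 2 * s i \<le> (\<Sum>j<k. s (i + j))
    \<and> D / (3 * L) * s i \<le> (\<Sum>j<k. s (i + j))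
    \<and> (2 powr \<epsilon> - 1) * D / 12 * (s i / (D * 2 powr L)) powr \<epsilon> * s i \<le> (\<Sum>j<k. s (i + j))"
proof -
  define N where "N = D * 2 powr L"
  define a where "a = D / (3 * L)"
  define q where "q = 2 powr \<epsilon>"
  define b where "b = (q - 1) * D / 12"
  define B where "B = 2 * max 0 (b - a) / (1 - 4 powr (-\<epsilon>))"
  \<comment> \<open>\<open>\<tau> x\<close> is the average degree needed of a window starting at size \<open>x\<close>. Over two octaves
    \<open>\<Phi>\<close> drops by at least \<open>\<tau> x\<close> per halving of \<open>x\<close>, and \<open>B\<close> is the least weight with this property.\<close>
  define \<Phi> where "\<Phi> x = a * log 2 x + B * (x / N) powr \<epsilon>" for x
  define \<tau> where "\<tau> x = max a (b * (x / N) powr \<epsilon>)" for x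
  have N: "0 < N" using assms by (simp add: N_def)
  have a: "0 < a" using assms by (simp add: a_def)
  have q: "1 < q" "q \<le> 2"
    using assms powr_mono[of \<epsilon> 1 "2::real"] by (simp_all add: q_def)
  have b: "0 \<le> b" "b \<le> D / 12"
    using q assms by (auto simp: b_def field_simps intro: mult_right_mono)
  have q4: "4 powr (-\<epsilon>) = 1 / q\<^sup>2"
  proof -
    have "(4::real) powr \<epsilon> = (2 * 2) powr \<epsilon>" by simp
    also have "\<dots> = q * q" unfolding q_def by (rule powr_mult)
    finally show ?thesis by (simp add: powr_minus_divide power2_eq_square)
  qed
  have q4_less: "4 powr (-\<epsilon>) < 1" using q by (simp add: q4 one_less_power)
  have B: "0 \<le> B" "B * (1 - 4 powr (-\<epsilon>)) = 2 * max 0 (b - a)"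
    using q4_less assms(4) by (simp_all add: B_def)
  \<comment> \<open>Weakening \<open>a\<close> to \<open>(q - 1) * a\<close> puts the factor
    \<open>q - 1\<close> into the bound for \<open>b - a\<close>. It cancels against
    \<open>1 - 4 powr (-\<epsilon>)\<close>, so the result is uniform in \<open>\<epsilon>\<close>;
    the worst case is \<open>q = 2\<close>, where \<open>q\<^sup>2 / (q + 1)\<close> is 4/3.\<close>
  have B_le: "B / D \<le> 2/9 * max 0 (1 - 4 / L)"
  proof (cases "a < b")
    case True
    have "b - a \<le> (q - 1) * D / 12 * (1 - 4 / L)"
    proof -
      have "(q - 1) * (D / (3 * L)) \<le> 1 * (D / (3 * L))"
        using q assms by (intro mult_right_mono) auto
      moreover have "(q - 1) * D / 12 * (1 - 4 / L) = b - (q - 1) * (D / (3 * L))"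
        using assms by (simp add: b_def field_simps)
      ultimately show ?thesis unfolding a_def by linarith
    qed
    moreover have "B = 2 * (b - a) * q\<^sup>2 / ((q - 1) * (q + 1))"
      using True q by (simp add: B_def q4 field_simps power2_eq_square)
    ultimately have "B \<le> 2 * ((q - 1) * D / 12 * (1 - 4 / L)) * q\<^sup>2 / ((q - 1) * (q + 1))"
      using q by (simp only:) (intro divide_right_mono mult_right_mono mult_left_mono, auto)
    also have "\<dots> = (q - 1) * (D * (1 - 4 / L) / 6 * q\<^sup>2) / ((q - 1) * (q + 1))" by simp
    also have "\<dots> = D * (1 - 4 / L) / 6 * q\<^sup>2 / (q + 1)"
      using q by (intro nonzero_mult_divide_mult_cancel_left) simp
    also have "\<dots> = D * (1 - 4 / L) / 6 * (q\<^sup>2 / (q + 1))" by simp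
    also have "\<dots> \<le> D * (1 - 4 / L) / 6 * (4 / 3)"
    proof (intro mult_left_mono)
      have "0 \<le> (3 * q + 2) * (2 - q)" using q by simp
      then show "q\<^sup>2 / (q + 1) \<le> 4 / 3"
        using q by (simp add: field_simps power2_eq_square)
      have "D * (1 / (3 * L)) < D * (1 / 12)" using True b unfolding a_def by simp
      then have "1 / (3 * L) < 1 / 12" using assms(1) by (simp only: mult_less_cancel_left_pos)
      then show "0 \<le> D * (1 - 4 / L) / 6" using assms by (simp add: field_simps)
    qed
    also have "\<dots> = D * (2/9 * (1 - 4 / L))" by simp
    finally have "B / D \<le> 2/9 * (1 - 4 / L)" using assms(1) by (simp add: field_simps)
    also have "\<dots> \<le> 2/9 * max 0 (1 - 4 / L)" by (intro mult_left_mono) auto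
    finally show ?thesis .
  next
    case False
    then show ?thesis by (simp add: B_def)
  qed
  have \<Phi>_mono: "\<Phi> x \<le> \<Phi> y" if "0 < x" "x \<le> y" for x y
    unfolding \<Phi>_def using that a B N assms
    by (intro add_mono mult_left_mono powr_mono2 divide_right_mono) auto
  \<comment> \<open>Requiring \<open>D / 8\<close> remaining steps bounds the sizes, and with them
    the logarithm in the potential, from below.\<close>
  define I where "I = {i. i < \<delta> \<and> D / 8 \<le> real (\<delta> - i)}"
  have "finite I" "0 \<in> I" using assms by (auto simp: I_def)
  then obtain i where i: "i \<in> I" and i_min: "\<And>j. j \<in> I \<Longrightarrow> real i + \<Phi> (s i) \<le> real j + \<Phi> (s j)"
    using ex_is_arg_min_if_finite[of I "\<lambda>i. real i + \<Phi> (s i)"]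
    by (auto simp: is_arg_min_linorder)
  have pos: "0 < s t" if "t < \<delta>" for t using low[OF that] that by linarith
  have le_N: "s t \<le> N" if "t < \<delta>" for t using mono[of 0 t] that top N_def by simp
  have \<delta>: "0 < \<delta>" "i < \<delta>" using i by (auto simp: I_def)
  define T where "T = \<tau> (s i)"
  have T: "a \<le> T" "b * (s i / N) powr \<epsilon> \<le> T" by (auto simp: T_def \<tau>_def)
  have T_le: "T \<le> max a (D / 12)"
  proof -
    have "(s i / N) powr \<epsilon> \<le> 1" using pos[OF \<delta>(2)] le_N[OF \<delta>(2)] N assms by (intro powr_le1) auto
    then have "b * (s i / N) powr \<epsilon> \<le> b * 1" using b by (intro mult_left_mono) auto
    with b show ?thesis by (auto simp: T_def \<tau>_def)
  qed
  \<comment> \<open>One number \<open>U\<close> yields all three densities: \<open>T \<le> U\<close>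
    covers the two prescribed ones, \<open>real k \<le> 2 * U\<close> the one relative to the window
    length.\<close>
  have goal: ?thesis if "0 < k" "i + k \<le> \<delta>" "real k \<le> 2 * U" "U * s i \<le> (\<Sum>j<k. s (i + j))" "T \<le> U" for k U
  proof (intro exI conjI)
    show "0 < k" "i + k \<le> \<delta>" by fact+
    have *: "x * s i \<le> (\<Sum>j<k. s (i + j))" if "x \<le> U" for x
      using mult_right_mono[OF that, of "s i"] pos[OF \<delta>(2)] \<open>U * s i \<le> _\<close> by linarith
    show "real k / 2 * s i \<le> (\<Sum>j<k. s (i + j))"
      by (rule *) (use that in simp)
    show "D / (3 * L) * s i \<le> (\<Sum>j<k. s (i + j))"
      by (rule *) (use T that in \<open>simp add: a_def\<close>)
    show "(2 powr \<epsilon> - 1) * D / 12 * (s i / (D * 2 powr L)) powr \<epsilon> * s i \<le> (\<Sum>j<k. s (i + j))"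
      by (rule *) (use T that in \<open>simp add: b_def q_def N_def\<close>)
  qed
  show ?thesis
  proof (cases "T < 1")
    case True
    \<comment> \<open>A required density below 1 is met by a single matching.\<close>
    then show ?thesis using \<delta> by (intro goal[of 1 1]) auto
  next
    case False
    define k where "k = nat \<lfloor>2 * T\<rfloor>"
    have k: "0 < k" "real k \<le> 2 * T" using False unfolding k_def by linarith+
    define r where "r = real (\<delta> - i)"
    have r: "0 < r" "D / 8 \<le> r" "r \<le> s i" "real i = real \<delta> - r"
      using i low[OF \<delta>(2)] by (auto simp: I_def r_def)
    \<comment> \<open>The left side is \<open>D / 8\<close> plus a bound for \<open>2 * T\<close>,
      so that the window stays inside \<open>I\<close>. If this failed, then
      \<open>r \<le> s i\<close> would push \<open>real i + \<Phi> (s i)\<close> above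
      \<open>\<Phi> N\<close>, and index 0 would beat \<open>i\<close>.\<close>
    have far: "D / 8 + 2 * max a (D / 12) < r"
    proof (rule ccontr)
      assume "\<not> ?thesis"
      then have "r / D \<le> (D / 8 + 2 * max a (D / 12)) / D"
        using assms(1) by (intro divide_right_mono) auto
      also have "\<dots> = 1/8 + 2 * max (1 / (3*L)) (1/12)"
        using assms(1,3) by (auto simp: a_def max_def field_simps)
      finally have "1/3 + B / D + r / D + log 2 (1 / (r / D)) / (3*L) < 1"
        using r B B_le assms by (intro window_fits) (auto simp: field_simps)
      then have "D * (1/3 + B / D + r / D + log 2 (1 / (r / D)) / (3*L)) < D * 1"
        using assms(1) by (intro mult_strict_left_mono)
      moreover have "log 2 (1 / (r / D)) = log 2 D - log 2 r"
        using assms(1) r by (simp add: log_divide)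
      ultimately have "D / 3 + B + r + a * (log 2 D - log 2 r) < D"
        using assms(1) by (simp add: a_def distrib_left)
      moreover have "real i + a * log 2 r \<le> real i + \<Phi> r"
        using B by (simp add: \<Phi>_def)
      moreover have "\<Phi> r \<le> \<Phi> (s i)" using r by (intro \<Phi>_mono)
      moreover have "real i + \<Phi> (s i) \<le> \<Phi> (s 0)" using i_min[OF \<open>0 \<in> I\<close>] by simp
      moreover have "\<Phi> (s 0) \<le> \<Phi> N" using \<delta> pos le_N by (intro \<Phi>_mono) auto
      moreover have "\<Phi> N = D / 3 + a * log 2 D + B"
        using assms N by (simp add: \<Phi>_def N_def log_mult a_def distrib_left)
      ultimately show False using r assms(2) by argo
    qed
    have in_I: "i + j \<in> I" if "j < k" for j
    proof -
      have "real k < r" "real j < real k" using far k T_le assms(1) that by auto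
      then show ?thesis using far k T_le assms(1) \<delta> by (auto simp: I_def r_def)
    qed
    have decay: "2 powr (- real j / T) \<le> s (i + j) / s i" if j: "j < k" for j
    proof -
      have lt: "i + j < \<delta>" using in_I[OF j] by (simp add: I_def)
      note p = pos[OF lt] pos[OF \<delta>(2)]
      have le: "s (i + j) \<le> s i" using mono[OF _ lt] by simp
      have drop: "\<Phi> (s i) - \<Phi> (s (i + j)) \<le> real j" using i_min[OF in_I[OF j]] by simp
      have chord: "T * log 2 (s i / y) \<le> \<Phi> (s i) - \<Phi> y" if "0 < y" "y \<le> s i" "s i \<le> 4 * y" for y
        unfolding T_def \<tau>_def \<Phi>_def
        using assms a b that B le_N[OF \<delta>(2)] by (intro potential_drop) auto
      \<comment> \<open>A drop by more than a factor 4 contains two full halvings, which cost at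
        least \<open>2 * T\<close> in potential, whereas \<open>j < k\<close> and \<open>k\<close>
        is at most \<open>2 * T\<close>.\<close>
      have "s i \<le> 4 * s (i + j)"
      proof (rule ccontr)
        assume "\<not> ?thesis"
        then have "\<Phi> (s (i + j)) \<le> \<Phi> (s i / 4)" using p by (intro \<Phi>_mono) auto
        moreover have "T * log 2 (s i / (s i / 4)) \<le> \<Phi> (s i) - \<Phi> (s i / 4)"
          using p by (intro chord) auto
        moreover have "log 2 (4::real) = 2" using log_pow_cancel[of "2::real" 2] by simp
        ultimately have "2 * T \<le> real j" using drop p by simp
        with k j show False by simp
      qed
      then have "T * log 2 (s i / s (i + j)) \<le> real j" using chord[of "s (i + j)"] p le drop by simp
      then have "- real j / T \<le> log 2 (s (i + j) / s i)"
        using False p by (simp add: log_divide field_simps)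
      then show ?thesis using p by (simp add: le_log_iff)
    qed
    have "T \<le> (\<Sum>j<k. s (i + j) / s i)"
      using False decay by (intro sum_ge_of_halving) (auto simp: k_def)
    then have "T * s i \<le> (\<Sum>j<k. s (i + j))"
      using pos[OF \<delta>(2)] by (simp add: field_simps flip: sum_divide_distrib)
    moreover have "i + k \<le> \<delta>" using in_I[of "k - 1"] k by (auto simp: I_def)
    ultimately show ?thesis using k by (intro goal[of k T]) auto
  qed
qed

subsection \<open>Nested matchings\<close>

text \<open>The Halmos-Vaughan induction: either some proper subfamily is tight, and it is matched
  first while the rest avoids the elements it uses up, or every proper subfamily has a surplus, and
  any single choice can be fixed.\<close>

lemma hall_marriage:
  assumes "finite I" and "\<And>i. i \<in> I \<Longrightarrow> finite (S i)"
    and "\<And>J. J \<subseteq> I \<Longrightarrow> card J \<le> card (\<Union> (S ` J))"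
  shows "\<exists>f. inj_on f I \<and> (\<forall>i\<in>I. f i \<in> S i)"
  using assms
proof (induction "card I" arbitrary: I S rule: less_induct)
  case less
  note fin = less.prems(1) and finS = less.prems(2) and hall = less.prems(3)
  show ?case
  proof (cases "\<exists>J. J \<subset> I \<and> J \<noteq> {} \<and> card (\<Union> (S ` J)) = card J")
    case True
    then obtain J where J: "J \<subset> I" "J \<noteq> {}" "card (\<Union> (S ` J)) = card J" by blast
    have finJ: "finite J" using J fin finite_subset by blast
    have "\<exists>f. inj_on f J \<and> (\<forall>i\<in>J. f i \<in> S i)"
      using J finJ finS hall psubset_card_mono[OF fin J(1)] by (intro less.hyps) auto
    then obtain f where f: "inj_on f J" "\<forall>i\<in>J. f i \<in> S i" by blast
    define S' where "S' i = S i - \<Union> (S ` J)" for i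
    have "\<exists>g. inj_on g (I - J) \<and> (\<forall>i\<in>I - J. g i \<in> S' i)"
    proof (rule less.hyps)
      show "card (I - J) < card I" using J fin by (intro psubset_card_mono) auto
      show "finite (I - J)" "\<And>i. i \<in> I - J \<Longrightarrow> finite (S' i)" using fin finS by (auto simp: S'_def)
      fix K assume K: "K \<subseteq> I - J"
      \<comment> \<open>Hall's condition for the union with \<open>J\<close>, minus the equality for
        \<open>J\<close>, leaves the condition for \<open>K\<close> in the reduced sets.\<close>
      then have "card (K \<union> J) \<le> card (\<Union> (S ` (K \<union> J)))" using J by (intro hall) auto
      also have "\<Union> (S ` (K \<union> J)) = \<Union> (S' ` K) \<union> \<Union> (S ` J)" by (auto simp: S'_def)
      also have "card \<dots> \<le> card (\<Union> (S' ` K)) + card (\<Union> (S ` J))" by (rule card_Un_le)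
      also have "card (K \<union> J) = card K + card J"
        using K fin finJ by (intro card_Un_disjoint) (auto intro: finite_subset)
      finally show "card K \<le> card (\<Union> (S' ` K))" using J by simp
    qed
    then obtain g where g: "inj_on g (I - J)" "\<forall>i\<in>I - J. g i \<in> S' i" by blast
    define h where "h i = (if i \<in> J then f i else g i)" for i
    have "f ` J \<inter> g ` (I - J) = {}" using f g by (auto simp: S'_def)
    from inj_on_disjoint_Un[OF f(1) g(1) this] have "inj_on h I"
      using J unfolding h_def by (simp add: Un_absorb1 psubset_imp_subset)
    moreover have "\<forall>i\<in>I. h i \<in> S i" using f g by (auto simp: h_def S'_def)
    ultimately show ?thesis by blast
  next
    case surplus: False
    show ?thesis
    proof (cases "I = {}")
      case False
      then obtain i where i: "i \<in> I" by blast
      have "card {i} \<le> card (\<Union> (S ` {i}))" using i by (intro hall) auto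
      then obtain x where x: "x \<in> S i" by fastforce
      define S' where "S' j = S j - {x}" for j
      have "\<exists>g. inj_on g (I - {i}) \<and> (\<forall>j\<in>I - {i}. g j \<in> S' j)"
      proof (rule less.hyps)
        show "card (I - {i}) < card I" using i fin by (rule card_Diff1_less[rotated])
        show "finite (I - {i})" "\<And>j. j \<in> I - {i} \<Longrightarrow> finite (S' j)" using fin finS by (auto simp: S'_def)
        fix K assume K: "K \<subseteq> I - {i}"
        show "card K \<le> card (\<Union> (S' ` K))"
        proof (cases "K = {}")
          case False
          have "K \<subset> I" using K i by blast
          then have "card K < card (\<Union> (S ` K))"
            using surplus hall[of K] False by (metis order_le_less psubset_imp_subset)
          moreover have "\<Union> (S' ` K) = \<Union> (S ` K) - {x}" by (auto simp: S'_def)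
          ultimately show ?thesis by (simp add: card_Diff_singleton_if) linarith
        qed simp
      qed
      then obtain g where g: "inj_on g (I - {i})" "\<forall>j\<in>I - {i}. g j \<in> S' j" by blast
      have "inj_on (g(i := x)) I" using g unfolding inj_on_def S'_def by auto
      moreover have "\<forall>j\<in>I. (g(i := x)) j \<in> S j" using g x by (auto simp: S'_def)
      ultimately show ?thesis by blast
    qed simp
  qed
qed

text \<open>In a smallest nonempty \<open>X\<close> with at most \<open>card X\<close> neighbours,
  all proper nonempty subsets expand strictly. Deleting one vertex then shows that \<open>X\<close>
  has exactly \<open>card X\<close> neighbours, so Hall's theorem gives an injection that must be
  onto.\<close>

lemma exists_tight_matching:
  assumes "finite A" "A \<noteq> {}" and fin: "\<And>a. a \<in> A \<Longrightarrow> finite (N a)"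
    and ne: "\<And>a. a \<in> A \<Longrightarrow> N a \<noteq> {}"
    and "card (\<Union> (N ` A)) \<le> card A"
  shows "\<exists>A' f. A' \<subseteq> A \<and> A' \<noteq> {} \<and> bij_betw f A' (\<Union> (N ` A')) \<and> (\<forall>a\<in>A'. f a \<in> N a)"
proof -
  define P where "P X \<longleftrightarrow> X \<subseteq> A \<and> X \<noteq> {} \<and> card (\<Union> (N ` X)) \<le> card X" for X
  have "P A" using assms by (simp add: P_def)
  then obtain X where X: "P X" and min: "\<And>Y. P Y \<Longrightarrow> card X \<le> card Y"
    using ex_has_least_nat[of P A card] by blast
  have finX: "finite X" using X assms(1) finite_subset by (auto simp: P_def)
  have finN: "finite (\<Union> (N ` X))" using finX X fin by (auto simp: P_def)
  have strict: "card Y < card (\<Union> (N ` Y))" if "Y \<subset> X" "Y \<noteq> {}" for Y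
    using min[of Y] that X psubset_card_mono[OF finX that(1)] unfolding P_def
    by (meson leD not_le_imp_less order_trans psubset_imp_subset)
  have tight: "card X \<le> card (\<Union> (N ` X))"
  proof -
    obtain x where x: "x \<in> X" using X by (auto simp: P_def)
    show ?thesis
    proof (cases "X = {x}")
      case True
      have "N x \<noteq> {}" "finite (N x)" using x X ne fin by (auto simp: P_def)
      then show ?thesis using True by (simp add: card_gt_0_iff Suc_le_eq)
    next
      case False
      have "card (X - {x}) < card (\<Union> (N ` (X - {x})))" using False x by (intro strict) auto
      also have "\<dots> \<le> card (\<Union> (N ` X))" using finN by (intro card_mono) auto
      finally show ?thesis using x finX by simp
    qed
  qed
  have "\<exists>f. inj_on f X \<and> (\<forall>i\<in>X. f i \<in> N i)"
  proof (rule hall_marriage[OF finX])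
    show "\<And>i. i \<in> X \<Longrightarrow> finite (N i)" using X fin by (auto simp: P_def)
    fix J assume "J \<subseteq> X"
    then show "card J \<le> card (\<Union> (N ` J))"
      using strict[of J] tight by (cases "J = {}"; cases "J = X") (auto simp: less_imp_le psubsetI)
  qed
  then obtain f where f: "inj_on f X" "\<forall>i\<in>X. f i \<in> N i" by blast
  have "f ` X = \<Union> (N ` X)"
  proof (rule card_subset_eq[OF finN])
    show "f ` X \<subseteq> \<Union> (N ` X)" using f by blast
    then show "card (f ` X) = card (\<Union> (N ` X))"
      using X tight f by (simp add: P_def card_image)
  qed
  then have "X \<subseteq> A \<and> X \<noteq> {} \<and> bij_betw f X (\<Union> (N ` X)) \<and> (\<forall>a\<in>X. f a \<in> N a)"
    using X f by (simp add: P_def bij_betw_def)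
  then show ?thesis by blast
qed

text \<open>A tight matching covers the whole neighbourhood of its vertex set, so later matchings
  inside that set are nested on both sides. Deleting it lowers each degree by one, keeps the
  neighbourhood no larger than the vertex set, and makes later matchings disjoint from it.\<close>

lemma nested_matchings:
  assumes "finite A" "A \<noteq> {}" and "\<And>a. a \<in> A \<Longrightarrow> finite (N a)"
    and "\<And>a. a \<in> A \<Longrightarrow> \<delta> \<le> card (N a)"
    and "card (\<Union> (N ` A)) \<le> card A"
  shows "\<exists>X f. (\<forall>t<\<delta>. X t \<subseteq> A \<and> \<delta> - t \<le> card (X t) \<and> inj_on (f t) (X t) \<and> (\<forall>a\<in>X t. f t a \<in> N a))
    \<and> (\<forall>t t'. t \<le> t' \<and> t' < \<delta> \<longrightarrow> X t' \<subseteq> X t \<and> f t' ` X t' \<subseteq> f t ` X t)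
    \<and> (\<forall>t t'. t < t' \<and> t' < \<delta> \<longrightarrow> (\<forall>a\<in>X t'. f t a \<noteq> f t' a))"
  using assms
proof (induction \<delta> arbitrary: A N)
  case 0
  then show ?case by simp
next
  case (Suc \<delta>)
  have "N a \<noteq> {}" if "a \<in> A" for a using Suc.prems(4)[OF that] by auto
  then obtain A' g where A': "A' \<subseteq> A" "A' \<noteq> {}" and g: "bij_betw g A' (\<Union> (N ` A'))" "\<forall>a\<in>A'. g a \<in> N a"
    using exists_tight_matching[of A N] Suc.prems by metis
  have finA': "finite A'" using A' Suc.prems finite_subset by blast
  define N' where "N' a = N a - {g a}" for a
  have finN: "finite (\<Union> (N ` A'))" using finA' A' Suc.prems by auto
  have cardA': "card A' = card (\<Union> (N ` A'))" using g(1) by (rule bij_betw_same_card)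
  have "\<exists>X f. (\<forall>t<\<delta>. X t \<subseteq> A' \<and> \<delta> - t \<le> card (X t) \<and> inj_on (f t) (X t) \<and> (\<forall>a\<in>X t. f t a \<in> N' a))
    \<and> (\<forall>t t'. t \<le> t' \<and> t' < \<delta> \<longrightarrow> X t' \<subseteq> X t \<and> f t' ` X t' \<subseteq> f t ` X t)
    \<and> (\<forall>t t'. t < t' \<and> t' < \<delta> \<longrightarrow> (\<forall>a\<in>X t'. f t a \<noteq> f t' a))"
  proof (rule Suc.IH[OF finA' A'(2)])
    fix a assume a: "a \<in> A'"
    then have fN: "finite (N a)" "Suc \<delta> \<le> card (N a)" using A' Suc.prems by auto
    then show "finite (N' a)" "\<delta> \<le> card (N' a)" using a g by (auto simp: N'_def)
  next
    have "card (\<Union> (N' ` A')) \<le> card (\<Union> (N ` A'))"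
      using finN by (intro card_mono) (auto simp: N'_def)
    then show "card (\<Union> (N' ` A')) \<le> card A'" using cardA' by simp
  qed
  then obtain X f where X: "\<And>t. t < \<delta> \<Longrightarrow> X t \<subseteq> A' \<and> \<delta> - t \<le> card (X t) \<and> inj_on (f t) (X t) \<and> (\<forall>a\<in>X t. f t a \<in> N' a)"
    and nest: "\<And>t t'. t \<le> t' \<Longrightarrow> t' < \<delta> \<Longrightarrow> X t' \<subseteq> X t \<and> f t' ` X t' \<subseteq> f t ` X t"
    and dist: "\<And>t t' a. t < t' \<Longrightarrow> t' < \<delta> \<Longrightarrow> a \<in> X t' \<Longrightarrow> f t a \<noteq> f t' a"
    by metis
  define Y where "Y t = (case t of 0 \<Rightarrow> A' | Suc u \<Rightarrow> X u)" for t
  define h where "h t = (case t of 0 \<Rightarrow> g | Suc u \<Rightarrow> f u)" for t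
  have Y[simp]: "Y 0 = A'" "\<And>u. Y (Suc u) = X u" "h 0 = g" "\<And>u. h (Suc u) = f u"
    by (simp_all add: Y_def h_def)
  \<comment> \<open>A single vertex already has \<open>Suc \<delta>\<close> neighbours, and
    \<open>A'\<close> is as large as its whole neighbourhood.\<close>
  have big: "Suc \<delta> \<le> card A'"
  proof -
    obtain a where a: "a \<in> A'" using A' by blast
    then have "Suc \<delta> \<le> card (N a)" using A' Suc.prems by auto
    also have "\<dots> \<le> card (\<Union> (N ` A'))" using a finN by (intro card_mono) auto
    finally show ?thesis using cardA' by simp
  qed
  have c1: "Y t \<subseteq> A \<and> Suc \<delta> - t \<le> card (Y t) \<and> inj_on (h t) (Y t) \<and> (\<forall>a\<in>Y t. h t a \<in> N a)" if "t < Suc \<delta>" for t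
  proof (cases t)
    case 0
    then show ?thesis using A' g big by (auto simp: bij_betw_def)
  next
    case (Suc u)
    then show ?thesis using X[of u] that A' by (auto simp: N'_def)
  qed
  have c2: "Y t' \<subseteq> Y t \<and> h t' ` Y t' \<subseteq> h t ` Y t" if "t \<le> t'" "t' < Suc \<delta>" for t t'
  proof (cases t')
    case 0
    then show ?thesis using that by simp
  next
    case (Suc u')
    show ?thesis
    proof (cases t)
      case 0
      have "X u' \<subseteq> A'" "f u' ` X u' \<subseteq> \<Union> (N ` A')" using X[of u'] Suc that by (auto simp: N'_def)
      then show ?thesis using 0 Suc g by (simp add: bij_betw_def)
    next
      case (Suc u)
      then show ?thesis using \<open>t' = Suc u'\<close> nest[of u u'] that by simp
    qed
  qed
  have c3: "h t a \<noteq> h t' a" if "t < t'" "t' < Suc \<delta>" "a \<in> Y t'" for t t' a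
  proof (cases t)
    case 0
    then obtain u' where u': "t' = Suc u'" using \<open>t < t'\<close> by (cases t') auto
    then show ?thesis using 0 X[of u'] that by (auto simp: N'_def)
  next
    case (Suc u)
    then obtain u' where u': "t' = Suc u'" using \<open>t < t'\<close> by (cases t') auto
    then show ?thesis using Suc dist[of u u' a] that by simp
  qed
  show ?case
    by (intro exI[of _ Y] exI[of _ h] conjI[OF _ conjI] allI impI ballI c1 c2 c3) auto
qed

subsection \<open>Degrees, cuts and dense subgraphs\<close>

lemma finite_edges: "simple_graph V E \<Longrightarrow> finite E"
  by (rule finite_subset[of _ "Pow V"]) (auto simp: simple_graph_def)

lemma sum_degree:
  assumes "simple_graph V E"
  shows "(\<Sum>v\<in>V. degree E v) = 2 * card E"
proof -
  have fin: "finite V" "finite E" using assms finite_edges by (auto simp: simple_graph_def)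
  have "(\<Sum>v\<in>V. degree E v) = (\<Sum>v\<in>V. \<Sum>e\<in>E. if v \<in> e then 1 else 0)"
    using fin by (simp add: degree_def sum.If_cases Int_def)
  also have "\<dots> = (\<Sum>e\<in>E. \<Sum>v\<in>V. if v \<in> e then 1 else 0)" by (rule sum.swap)
  also have "\<dots> = (\<Sum>e\<in>E. 2)"
  proof (rule sum.cong)
    fix e assume "e \<in> E"
    then have "V \<inter> {v. v \<in> e} = e" "card e = 2" using assms by (auto simp: simple_graph_def)
    then show "(\<Sum>v\<in>V. if v \<in> e then 1 else 0) = (2::nat)" using fin by (simp add: sum.If_cases)
  qed simp
  finally show ?thesis by simp
qed

lemma avg_degree_eq:
  "simple_graph V E \<Longrightarrow> avg_degree V E = 2 * real (card E) / real (card V)"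
  using sum_degree[of V E] unfolding avg_degree_def by (simp flip: of_nat_sum)

lemma degree_mono: "finite E \<Longrightarrow> F \<subseteq> E \<Longrightarrow> degree F v \<le> degree E v"
  unfolding degree_def by (intro card_mono) auto

lemma degree_less_card:
  assumes "simple_graph V E" "v \<in> V"
  shows "degree E v < card V"
proof -
  have fin: "finite V" using assms by (simp add: simple_graph_def)
  have "{e \<in> E. v \<in> e} \<subseteq> (\<lambda>u. {v, u}) ` (V - {v})"
  proof
    fix e assume "e \<in> {e \<in> E. v \<in> e}"
    then have "card e = 2" "e \<subseteq> V" "v \<in> e" using assms by (auto simp: simple_graph_def)
    then obtain u where "e = {v, u}" "u \<noteq> v" by (auto simp: card_2_iff)
    with \<open>e \<subseteq> V\<close> show "e \<in> (\<lambda>u. {v, u}) ` (V - {v})" by auto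
  qed
  then have "degree E v \<le> card (V - {v})"
    unfolding degree_def using fin by (intro surj_card_le) auto
  also have "\<dots> < card V" using assms fin by (intro card_Diff1_less) auto
  finally show ?thesis .
qed

text \<open>Here \<open>q\<close> is half the average degree. A smallest vertex set inducing at
  least \<open>q\<close> edges per vertex has no vertex of degree below \<open>q\<close>, since
  removing one would keep that density.\<close>

lemma exists_min_degree_subgraph:
  assumes "simple_graph V E"
  defines "q \<equiv> real (card E) / real (card V)"
  shows "\<exists>W F. is_subgraph W F V E \<and> (\<forall>v\<in>W. q \<le> real (degree F v)) \<and> q * real (card W) \<le> real (card F)"
proof -
  define E' where "E' X = {e \<in> E. e \<subseteq> X}" for X
  define P where "P X \<longleftrightarrow> X \<subseteq> V \<and> X \<noteq> {} \<and> q * real (card X) \<le> real (card (E' X))" for X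
  have V: "finite V" "V \<noteq> {}" "finite E" using assms finite_edges by (auto simp: simple_graph_def)
  have "E' V = E" using assms by (auto simp: E'_def simple_graph_def)
  then have "P V" using V by (simp add: P_def q_def)
  then obtain W where W: "P W" and min: "\<And>Y. P Y \<Longrightarrow> card W \<le> card Y"
    using ex_has_least_nat[of P V card] by blast
  have finW: "finite W" using W V finite_subset by (auto simp: P_def)
  have "q \<le> real (degree (E' W) v)" if v: "v \<in> W" for v
  proof (cases "W = {v}")
    case True
    \<comment> \<open>Nothing would remain after a deletion, but a single vertex carries no edge,
      which forces \<open>q \<le> 0\<close>.\<close>
    have "E' W = {}"
      using assms True by (auto simp: E'_def simple_graph_def dest: card_mono[rotated])
    then show ?thesis using W True by (simp add: P_def)
  next
    case False
    have "card (W - {v}) < card W" using v finW by (intro card_Diff1_less)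
    then have "\<not> P (W - {v})" using min by fastforce
    then have "real (card (E' (W - {v}))) < q * real (card (W - {v}))"
      using W False v unfolding P_def by (metis Diff_eq_empty_iff Diff_subset not_le order_trans subset_singleton_iff)
    moreover have "card (E' W) = card (E' (W - {v})) + degree (E' W) v"
    proof -
      have "E' W = E' (W - {v}) \<union> {e \<in> E' W. v \<in> e}" by (auto simp: E'_def)
      moreover have "card (E' (W - {v}) \<union> {e \<in> E' W. v \<in> e}) = card (E' (W - {v})) + card {e \<in> E' W. v \<in> e}"
        using V by (intro card_Un_disjoint) (auto simp: E'_def)
      ultimately show ?thesis by (simp add: degree_def)
    qed
    moreover have "real (card W) = real (card (W - {v})) + 1"
      using card_Suc_Diff1[OF finW v] by (metis of_nat_Suc add.commute)
    moreover have "q * real (card W) \<le> real (card (E' W))" using W by (simp add: P_def)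
    ultimately show ?thesis by (simp add: algebra_simps)
  qed
  moreover have "is_subgraph W (E' W) V E"
    using W assms finW by (auto simp: is_subgraph_def simple_graph_def P_def E'_def)
  moreover have "q * real (card W) \<le> real (card (E' W))" using W by (simp add: P_def)
  ultimately show ?thesis by blast
qed

text \<open>In a maximum cut, moving \<open>a\<close> across exchanges the cut and uncut edges at
  \<open>a\<close>, so at least half of them are cut. Complementing a side keeps the cut, so
  \<open>A\<close> may be taken as the larger side.\<close>

lemma exists_large_cut:
  assumes "simple_graph W F" and "\<And>v. v \<in> W \<Longrightarrow> q \<le> real (degree F v)"
  shows "\<exists>A\<subseteq>W. A \<noteq> {} \<and> card (W - A) \<le> card A \<and> (\<forall>a\<in>A. q / 2 \<le> real (card {b \<in> W - A. {a, b} \<in> F}))"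
proof -
  have W: "finite W" "W \<noteq> {}" "finite F" using assms finite_edges by (auto simp: simple_graph_def)
  define X where "X A = {e \<in> F. card (e \<inter> A) = 1}" for A
  obtain A0 where A0: "A0 \<subseteq> W" and max: "\<And>A. A \<subseteq> W \<Longrightarrow> card (X A) \<le> card (X A0)"
  proof -
    have "\<exists>A. A \<subseteq> W \<and> (\<forall>B. B \<subseteq> W \<longrightarrow> card (X B) \<le> card (X A))"
      using ex_has_greatest_nat[of "\<lambda>A. A \<subseteq> W" "{}" "\<lambda>A. card (X A)" "Suc (card F)"] W
      by (simp add: X_def less_Suc_eq_le card_mono)
    then show thesis using that by blast
  qed
  have compl: "X (W - A) = X A" if "A \<subseteq> W" for A
  proof -
    have "card (e \<inter> (W - A)) = 1 \<longleftrightarrow> card (e \<inter> A) = 1" if e: "e \<in> F" for e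
    proof -
      have e2: "e \<subseteq> W" "card e = 2" "finite e"
        using assms e W by (auto simp: simple_graph_def intro: finite_subset)
      have "e = (e \<inter> A) \<union> (e \<inter> (W - A))" using e2 by blast
      moreover have "card ((e \<inter> A) \<union> (e \<inter> (W - A))) = card (e \<inter> A) + card (e \<inter> (W - A))"
        using e2 by (intro card_Un_disjoint) auto
      ultimately have "card e = card (e \<inter> A) + card (e \<inter> (W - A))" by simp
      with e2 show ?thesis by linarith
    qed
    then show ?thesis unfolding X_def by blast
  qed
  obtain A where A: "A \<subseteq> W" "card (W - A) \<le> card A" "\<And>B. B \<subseteq> W \<Longrightarrow> card (X B) \<le> card (X A)"
  proof (cases "card (W - A0) \<le> card A0")
    case True
    then show ?thesis using that[of A0] A0 max by blast
  next
    case False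
    moreover have "W - (W - A0) = A0" using A0 by blast
    ultimately show ?thesis using that[of "W - A0"] A0 max compl by simp
  qed
  have "q / 2 \<le> real (card {b \<in> W - A. {a, b} \<in> F})" if a: "a \<in> A" for a
  proof -
    define E\<^sub>a where "E\<^sub>a = {e \<in> F. a \<in> e}"
    have card2: "e \<subseteq> W \<and> (\<exists>b. e = {a, b} \<and> b \<noteq> a)" if "e \<in> E\<^sub>a" for e
    proof -
      have "e \<subseteq> W" "card e = 2" "a \<in> e" using that assms by (auto simp: simple_graph_def E\<^sub>a_def)
      then show ?thesis by (auto simp: card_2_iff)
    qed
    have flip: "X (A - {a}) = (X A - E\<^sub>a) \<union> (E\<^sub>a - X A)"
    proof -
      have "e \<in> X (A - {a}) \<longleftrightarrow> e \<in> X A" if "e \<notin> E\<^sub>a" for e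
      proof (cases "e \<in> F")
        case True
        then have "e \<inter> (A - {a}) = e \<inter> A" using that by (auto simp: E\<^sub>a_def)
        then show ?thesis by (simp add: X_def)
      qed (simp add: X_def)
      moreover have "e \<in> X (A - {a}) \<longleftrightarrow> e \<notin> X A" if "e \<in> E\<^sub>a" for e
      proof -
        obtain b where b: "e = {a, b}" "b \<noteq> a" using card2[OF \<open>e \<in> E\<^sub>a\<close>] by blast
        have "e \<in> F" using that by (simp add: E\<^sub>a_def)
        then show ?thesis using a b by (cases "b \<in> A") (auto simp: X_def Int_insert_left)
      qed
      ultimately show ?thesis by blast
    qed
    have finX: "finite (X A)" "finite E\<^sub>a" using W by (auto simp: X_def E\<^sub>a_def)
    have "card (X A - E\<^sub>a) + card (E\<^sub>a - X A) = card (X (A - {a}))"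
      unfolding flip using finX by (intro card_Un_disjoint[symmetric]) auto
    also have "\<dots> \<le> card (X A)" using A by (intro A(3)) auto
    also have "\<dots> = card (X A - E\<^sub>a) + card (E\<^sub>a \<inter> X A)"
      using card_Int_Diff[OF finX(1), of E\<^sub>a] by (simp add: Int_commute)
    finally have "card (E\<^sub>a - X A) \<le> card (E\<^sub>a \<inter> X A)" by simp
    moreover have "card E\<^sub>a = card (E\<^sub>a - X A) + card (E\<^sub>a \<inter> X A)"
      using card_Int_Diff[OF finX(2), of "X A"] by simp
    ultimately have "real (card E\<^sub>a) \<le> 2 * real (card (E\<^sub>a \<inter> X A))" by simp
    moreover have "q \<le> real (card E\<^sub>a)" using assms(2)[of a] a A by (auto simp: degree_def E\<^sub>a_def)
    moreover have "card (E\<^sub>a \<inter> X A) \<le> card {b \<in> W - A. {a, b} \<in> F}"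
    proof (rule surj_card_le)
      show "finite {b \<in> W - A. {a, b} \<in> F}" using W by simp
      show "E\<^sub>a \<inter> X A \<subseteq> (\<lambda>b. {a, b}) ` {b \<in> W - A. {a, b} \<in> F}"
      proof
        fix e assume e: "e \<in> E\<^sub>a \<inter> X A"
        then obtain b where b: "e = {a, b}" "b \<noteq> a" "e \<subseteq> W" using card2 by blast
        have "b \<notin> A"
          using e a b by (auto simp: X_def Int_insert_left)
        then show "e \<in> (\<lambda>b. {a, b}) ` {b \<in> W - A. {a, b} \<in> F}" using b e by (auto simp: E\<^sub>a_def)
      qed
    qed
    ultimately show ?thesis by linarith
  qed
  moreover have "A \<noteq> {}" using A W by auto
  ultimately show ?thesis using A by blast
qed

section \<open>Assembling the almost-regular subgraph from matchings\<close>

text \<open>Since the values of each \<open>f t\<close> avoid \<open>A\<close>, an edge determines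
  its end in \<open>A\<close>, so distinct values mean disjoint matchings; each matching adds at
  most one to a degree.\<close>

lemma union_of_matchings:
  fixes X :: "nat \<Rightarrow> 'a set" and f :: "nat \<Rightarrow> 'a \<Rightarrow> 'a"
  assumes fin: "finite A" and disj: "\<And>t a. t < k \<Longrightarrow> a \<in> X t \<Longrightarrow> f t a \<notin> A"
    and X: "\<And>t. t < k \<Longrightarrow> X t \<subseteq> A" "\<And>t. t < k \<Longrightarrow> inj_on (f t) (X t)"
    and dist: "\<And>t t' a. t < t' \<Longrightarrow> t' < k \<Longrightarrow> a \<in> X t \<Longrightarrow> a \<in> X t' \<Longrightarrow> f t a \<noteq> f t' a"
  defines "M \<equiv> \<Union>t<k. (\<lambda>a. {a, f t a}) ` X t"
  shows "card M = (\<Sum>t<k. card (X t))" "degree M v \<le> k"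
proof -
  have finX: "finite (X t)" if "t < k" for t using X(1)[OF that] fin finite_subset by blast
  have inj: "inj_on (\<lambda>a. {a, f t a}) (X t)" if "t < k" for t
    using X(1)[OF that] disj[OF that] by (intro inj_onI) (auto simp: doubleton_eq_iff)
  have "card M = (\<Sum>t<k. card ((\<lambda>a. {a, f t a}) ` X t))"
    unfolding M_def
  proof (rule card_UN_disjoint)
    show "\<forall>t\<in>{..<k}. finite ((\<lambda>a. {a, f t a}) ` X t)" using finX by simp
    have *: "((\<lambda>a. {a, f t a}) ` X t) \<inter> ((\<lambda>a. {a, f t' a}) ` X t') = {}" if "t < t'" "t' < k" for t t'
    proof -
      have tk: "t < k" using that by simp
      show ?thesis
        using X(1)[OF that(2)] disj[OF that(2)] X(1)[OF tk] disj[OF tk] dist[OF that]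
        by (auto simp: doubleton_eq_iff) (meson subsetD)
    qed
    show "\<forall>t\<in>{..<k}. \<forall>t'\<in>{..<k}. t \<noteq> t' \<longrightarrow> ((\<lambda>a. {a, f t a}) ` X t) \<inter> ((\<lambda>a. {a, f t' a}) ` X t') = {}"
    proof (intro ballI impI)
      fix t t' assume "t \<in> {..<k}" "t' \<in> {..<k}" "t \<noteq> t'"
      then show "((\<lambda>a. {a, f t a}) ` X t) \<inter> ((\<lambda>a. {a, f t' a}) ` X t') = {}"
        using *[of t t'] *[of t' t] by (cases t t' rule: linorder_cases) (simp_all add: Int_commute)
    qed
  qed simp
  then show "card M = (\<Sum>t<k. card (X t))" using inj by (simp add: card_image)
  have "{e \<in> M. v \<in> e} = (\<Union>t<k. {e \<in> (\<lambda>a. {a, f t a}) ` X t. v \<in> e})" by (auto simp: M_def)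
  then have "degree M v \<le> (\<Sum>t<k. card {e \<in> (\<lambda>a. {a, f t a}) ` X t. v \<in> e})"
    unfolding degree_def by (simp add: card_UN_le)
  also have "\<dots> \<le> (\<Sum>t<k. 1)"
  proof (rule sum_mono)
    fix t assume "t \<in> {..<k}"
    then have t: "t < k" by simp
    have "e = e'" if "e \<in> (\<lambda>a. {a, f t a}) ` X t" "v \<in> e" "e' \<in> (\<lambda>a. {a, f t a}) ` X t" "v \<in> e'" for e e'
      using that X(1)[OF t] disj[OF t] inj_onD[OF X(2)[OF t]] by auto
    then show "card {e \<in> (\<lambda>a. {a, f t a}) ` X t. v \<in> e} \<le> 1"
      using finX[OF t] by (subst card_le_Suc0_iff_eq[folded One_nat_def]) auto
  qed
  finally show "degree M v \<le> k" by simp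
qed

lemma is_subgraph_trans:
  "is_subgraph W F V' E' \<Longrightarrow> is_subgraph V' E' V E \<Longrightarrow> is_subgraph W F V E"
  by (auto simp: is_subgraph_def)

text \<open>Passing to a subgraph of minimum degree at least \<open>q\<close> can only lower the
  maximum degree, so the bound \<open>\<mu> * q\<close> survives.\<close>

lemma exists_almost_regular_subgraph:
  assumes "simple_graph V E"
    and deg: "\<And>v. v \<in> V \<Longrightarrow> real (degree E v) \<le> \<mu> * q"
    and q: "q = real (card E) / real (card V)" and "0 \<le> \<mu>"
  shows "\<exists>W F. is_subgraph W F V E \<and> almost_regular \<mu> W F \<and> q * real (card W) \<le> real (card F)"
proof -
  obtain W F where WF: "is_subgraph W F V E" "\<And>v. v \<in> W \<Longrightarrow> q \<le> real (degree F v)"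
      "q * real (card W) \<le> real (card F)"
    using exists_min_degree_subgraph[OF assms(1)] unfolding q by blast
  have W: "finite W" "W \<noteq> {}" using WF(1) by (auto simp: is_subgraph_def simple_graph_def)
  obtain v where v: "v \<in> W" "max_degree W F = degree F v"
    using W Max_in[of "degree F ` W"] unfolding max_degree_def by blast
  obtain u where u: "u \<in> W" "min_degree W F = degree F u"
    using W Min_in[of "degree F ` W"] unfolding min_degree_def by blast
  have "real (degree F v) \<le> real (degree E v)"
    using degree_mono[OF finite_edges[OF assms(1)]] WF(1) by (simp add: is_subgraph_def)
  also have "\<dots> \<le> \<mu> * q" using deg v(1) WF(1) by (auto simp: is_subgraph_def)
  also have "\<dots> \<le> \<mu> * real (degree F u)" using WF(2)[OF u(1)] assms(4) by (rule mult_left_mono)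
  finally have "almost_regular \<mu> W F" by (simp add: almost_regular_def u v)
  then show ?thesis using WF by blast
qed

text \<open>The densities are half those of \<open>exists_dense_window\<close>, because the subgraph
  has \<open>2 * s i\<close> vertices: both ends of the \<open>i\<close>-th matching. By nestedness
  they span all later matchings of the window.\<close>

lemma exists_dense_union_of_matchings:
  fixes \<epsilon> D L :: real and V :: "'a set" and E :: "'a set set"
  assumes \<epsilon>: "0 < \<epsilon>" "\<epsilon> < 1" and G: "simple_graph V E"
    and D: "D = real (card E) / (2 * real (card V))" "0 < D"
    and L: "5/2 \<le> L" "D * 2 powr L = real (card V) / 2"
  shows "\<exists>W M k. is_subgraph W M V E \<and> (\<forall>v. degree M v \<le> k) \<and> real k / 4 * real (card W) \<le> real (card M)
    \<and> D / (6 * L) * real (card W) \<le> real (card M)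
    \<and> (2 powr \<epsilon> - 1) * D / 24 * (real (card W) / real (card V)) powr \<epsilon> * real (card W) \<le> real (card M)"
proof -
  \<comment> \<open>The minimum degree is half the average degree \<open>4 * D\<close>, and the cut
    below halves it once more to \<open>D\<close>.\<close>
  obtain W F where WF: "is_subgraph W F V E" "\<And>v. v \<in> W \<Longrightarrow> 2 * D \<le> real (degree F v)"
    using exists_min_degree_subgraph[OF G] D by auto
  have W: "simple_graph W F" "finite W" "W \<subseteq> V" "F \<subseteq> E" "finite V"
    using WF(1) G by (auto simp: is_subgraph_def simple_graph_def)
  obtain A where A: "A \<subseteq> W" "A \<noteq> {}" "card (W - A) \<le> card A"
      and nbrs: "\<And>a. a \<in> A \<Longrightarrow> D \<le> real (card {b \<in> W - A. {a, b} \<in> F})"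
    using exists_large_cut[OF W(1) WF(2)] by auto
  define N where "N a = {b \<in> W - A. {a, b} \<in> F}" for a
  define \<delta> where "\<delta> = nat \<lceil>D\<rceil>"
  have finA: "finite A" using A W finite_subset by blast
  have cardN: "card (\<Union> (N ` A)) \<le> card (W - A)"
    using W by (intro card_mono) (auto simp: N_def)
  have half: "2 * card (W - A) \<le> card V"
  proof -
    have "card (W - A) + card A = card W"
      using A W finA card_mono[of W A] by (simp add: card_Diff_subset)
    moreover have "card W \<le> card V" using W by (intro card_mono)
    ultimately show ?thesis using A by simp
  qed
  have degN: "\<delta> \<le> card (N a)" if "a \<in> A" for a
    using nbrs[OF that] unfolding \<delta>_def N_def by linarith
  have finN: "finite (N a)" for a using W by (simp add: N_def)
  obtain X f where XF: "\<forall>t<\<delta>. X t \<subseteq> A \<and> \<delta> - t \<le> card (X t) \<and> inj_on (f t) (X t) \<and> (\<forall>a\<in>X t. f t a \<in> N a)"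
      "\<forall>t t'. t \<le> t' \<and> t' < \<delta> \<longrightarrow> X t' \<subseteq> X t \<and> f t' ` X t' \<subseteq> f t ` X t"
      "\<forall>t t'. t < t' \<and> t' < \<delta> \<longrightarrow> (\<forall>a\<in>X t'. f t a \<noteq> f t' a)"
    using nested_matchings[OF finA A(2) finN degN order_trans[OF cardN A(3)]] by auto
  have X: "X t \<subseteq> A" "\<delta> - t \<le> card (X t)" "inj_on (f t) (X t)" "\<And>a. a \<in> X t \<Longrightarrow> f t a \<in> N a"
    if "t < \<delta>" for t using XF(1) that by auto
  have nest: "X t' \<subseteq> X t" "f t' ` X t' \<subseteq> f t ` X t" if "t \<le> t'" "t' < \<delta>" for t t'
    using XF(2) that by blast+
  have dist: "f t a \<noteq> f t' a" if "t < t'" "t' < \<delta>" "a \<in> X t'" for t t' a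
    using XF(3) that by blast
  have finX: "finite (X t)" if "t < \<delta>" for t using X(1)[OF that] finA finite_subset by blast
  define s where "s t = real (card (X t))" for t
  have "0 < \<delta>" "D \<le> real \<delta>" using D unfolding \<delta>_def by linarith+
  \<comment> \<open>The first matching embeds into the smaller side of the cut, which has at most
    half of the vertices.\<close>
  have "s 0 \<le> D * 2 powr L"
  proof -
    have "card (f 0 ` X 0) \<le> card (W - A)"
      using X(4)[OF \<open>0 < \<delta>\<close>] W by (intro card_mono) (auto simp: N_def)
    then have "2 * card (X 0) \<le> card V" using half X(3)[OF \<open>0 < \<delta>\<close>] by (simp add: card_image)
    then show ?thesis unfolding L s_def by linarith
  qed
  moreover have "s t' \<le> s t" if "t \<le> t'" "t' < \<delta>" for t t'
    using nest(1)[OF that] finX that by (simp add: s_def card_mono)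
  moreover have "real (\<delta> - t) \<le> s t" if "t < \<delta>" for t using X(2)[OF that] by (simp add: s_def)
  ultimately obtain i k where ik: "0 < k" "i + k \<le> \<delta>"
    and dense: "real k / 2 * s i \<le> (\<Sum>j<k. s (i + j))" "D / (3 * L) * s i \<le> (\<Sum>j<k. s (i + j))"
      "(2 powr \<epsilon> - 1) * D / 12 * (s i / (D * 2 powr L)) powr \<epsilon> * s i \<le> (\<Sum>j<k. s (i + j))"
    using exists_dense_window[OF D(2) \<open>D \<le> real \<delta>\<close> L(1) \<epsilon>, of s] by blast
  have i: "i < \<delta>" using ik by simp
  define M where "M = (\<Union>j<k. (\<lambda>a. {a, f (i + j) a}) ` X (i + j))"
  define U where "U = X i \<union> f i ` X i"
  have M: "card M = (\<Sum>j<k. card (X (i + j)))" "\<And>v. degree M v \<le> k"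
  proof -
    have "f (i + j) a \<notin> A" if "j < k" "a \<in> X (i + j)" for j a
      using X(4)[of "i + j" a] that ik by (auto simp: N_def)
    moreover have "X (i + j) \<subseteq> A" "inj_on (f (i + j)) (X (i + j))" if "j < k" for j
      using X that ik by auto
    moreover have "f (i + j) a \<noteq> f (i + j') a" if "j < j'" "j' < k" "a \<in> X (i + j')" for j j' a
      using dist[of "i + j" "i + j'" a] that ik by simp
    ultimately show "card M = (\<Sum>j<k. card (X (i + j)))" "degree M v \<le> k" for v
      unfolding M_def using finA
      by (intro union_of_matchings[where A = A and X = "\<lambda>j. X (i + j)" and f = "\<lambda>j. f (i + j)"]; blast)+
  qed
  have fU: "f i ` X i \<subseteq> W - A" using X(4)[OF i] by (auto simp: N_def)
  have "card U = card (X i) + card (f i ` X i)"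
    unfolding U_def using finX[OF i] fU X(1)[OF i] by (intro card_Un_disjoint) auto
  then have cardU: "real (card U) = 2 * s i" using X(3)[OF i] by (simp add: s_def card_image)
  have sub: "is_subgraph U M V E"
  proof -
    have "e \<subseteq> U \<and> card e = 2 \<and> e \<in> F" if "e \<in> M" for e
    proof -
      obtain j a where ja: "j < k" "a \<in> X (i + j)" "e = {a, f (i + j) a}"
        using \<open>e \<in> M\<close> unfolding M_def by blast
      have lt: "i + j < \<delta>" using ja ik by simp
      have "a \<in> X i" "f (i + j) a \<in> f i ` X i"
        using nest[of i "i + j"] lt ja by auto
      moreover have "f (i + j) a \<in> N a" using X(4) lt ja by blast
      moreover have "a \<in> A" using X(1) lt ja by blast
      ultimately have "e \<subseteq> U" "e \<in> F" using ja by (auto simp: U_def N_def)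
      then show ?thesis using W(1) by (simp add: simple_graph_def)
    qed
    moreover have "U \<subseteq> V" "finite U" using fU X(1)[OF i] A W finX[OF i] by (auto simp: U_def)
    moreover have "U \<noteq> {}" using X(2)[OF i] i by (auto simp: U_def)
    ultimately show ?thesis using W(4) unfolding is_subgraph_def simple_graph_def by blast
  qed
  have cardM: "real (card M) = (\<Sum>j<k. s (i + j))" by (simp add: M s_def)
  have "s i / (D * 2 powr L) = real (card U) / real (card V)" unfolding L cardU by simp
  with dense have "real k / 4 * real (card U) \<le> real (card M)" "D / (6 * L) * real (card U) \<le> real (card M)"
    "(2 powr \<epsilon> - 1) * D / 24 * (real (card U) / real (card V)) powr \<epsilon> * real (card U) \<le> real (card M)"
    unfolding cardM cardU by (simp_all add: mult_ac)
  with sub M(2) show ?thesis by blast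
qed

theorem theorem1p3:
  fixes \<epsilon> c :: real and n :: nat and V :: "'a set" and E :: "'a set set"
  assumes "0 < \<epsilon>" and "\<epsilon> < 1" and "c > 0"
    and "simple_graph V E" and "card V = n"
    and "real (card E) \<ge> c * real n powr (1 + \<epsilon>)"
  shows "\<exists>W F m. is_subgraph W F V E \<and> card W = m \<and> almost_regular 6 W F
    \<and> real (card F) \<ge> (2 powr \<epsilon> - 1) / 48 * c * real m powr (1 + \<epsilon>)
    \<and> avg_degree W F \<ge> 1 / 12 * (avg_degree V E / log 2 (2 * real n / avg_degree V E))"
proof -
  define D where "D = real (card E) / (2 * real n)"
  define L where "L = log 2 (real n / (2 * D))"
  have n: "0 < n" using assms(4,5) by (auto simp: simple_graph_def card_gt_0_iff)
  have avg: "avg_degree V E = 4 * D" using avg_degree_eq[OF assms(4)] assms(5) by (simp add: D_def)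
  have L_eq: "log 2 (2 * real n / avg_degree V E) = L" unfolding avg L_def by simp
  have "c * real n powr \<epsilon> * real n \<le> 2 * D * real n"
    using assms(6) n by (simp add: powr_add D_def mult_ac)
  then have D_ge: "c * real n powr \<epsilon> \<le> 2 * D" using n by simp
  have "0 < c * real n powr \<epsilon>" using n assms(3) by simp
  then have D: "0 < D" using D_ge by linarith
  have "4 * D < real n"
  proof -
    have "avg_degree V E < (\<Sum>v\<in>V. real n) / real n"
      unfolding avg_degree_def assms(5)
      using assms(4,5) degree_less_card[OF assms(4)] n
      by (intro divide_strict_right_mono sum_strict_mono) (auto simp: simple_graph_def)
    then show ?thesis using avg assms(5) n by simp
  qed
  then have L: "1 \<le> L" unfolding L_def using D by (subst le_log_iff) (auto simp: field_simps)
  define C where "C = (2 powr \<epsilon> - 1) * D / 24"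
  have q: "0 \<le> 2 powr \<epsilon> - 1" "2 powr \<epsilon> - 1 \<le> (1::real)"
    using assms(1,2) powr_mono[of \<epsilon> 1 "2::real"] ge_one_powr_ge_zero[of 2 \<epsilon>] by simp_all
  \<comment> \<open>Both cases end here: an edge density \<open>p\<close> that meets both targets,
    with degrees at most \<open>6 * p\<close>, survives the passage to an almost-regular
    subgraph.\<close>
  have finish: ?thesis
    if H: "is_subgraph W M V E" "\<And>v. v \<in> W \<Longrightarrow> real (degree M v) \<le> 6 * p" "p = real (card M) / real (card W)"
      and p: "D / (6 * L) \<le> p" "C * (real (card W) / real n) powr \<epsilon> \<le> p" for W M p
  proof -
    have W: "simple_graph W M" "finite W" using H(1) by (auto simp: is_subgraph_def simple_graph_def)
    obtain W' F where WF: "is_subgraph W' F W M" "almost_regular 6 W' F" "p * real (card W') \<le> real (card F)"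
      using exists_almost_regular_subgraph[OF W(1) H(2,3)] by auto
    define m where "m = card W'"
    have W': "simple_graph W' F" "0 < m" "m \<le> card W"
      using WF(1) W by (auto simp: is_subgraph_def simple_graph_def m_def card_gt_0_iff card_mono)
    have "(2 powr \<epsilon> - 1) / 48 * c * real m powr \<epsilon> \<le> p"
    proof -
      have "(2 powr \<epsilon> - 1) / 48 * c * real m powr \<epsilon>
          = (2 powr \<epsilon> - 1) / 48 * (c * real n powr \<epsilon>) * (real m / real n) powr \<epsilon>"
        using n by (simp add: powr_divide)
      \<comment> \<open>By \<open>D_ge\<close>, \<open>c * real n powr \<epsilon>\<close> is traded
        for \<open>2 * D\<close>, which turns the constant 48 into the 24 of
        \<open>C\<close>.\<close>
      also have "\<dots> \<le> (2 powr \<epsilon> - 1) / 48 * (2 * D) * (real m / real n) powr \<epsilon>"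
        using q by (intro mult_right_mono mult_left_mono D_ge) auto
      also have "\<dots> = C * (real m / real n) powr \<epsilon>" by (simp add: C_def)
      also have "\<dots> \<le> C * (real (card W) / real n) powr \<epsilon>"
        using q D W' assms(1) unfolding C_def
        by (intro mult_left_mono powr_mono2 divide_right_mono) auto
      finally show ?thesis using p by linarith
    qed
    then have "(2 powr \<epsilon> - 1) / 48 * c * real m powr \<epsilon> * real m \<le> p * real m"
      by (intro mult_right_mono) auto
    also have "\<dots> \<le> real (card F)" using WF(3) by (simp add: m_def)
    also have "(2 powr \<epsilon> - 1) / 48 * c * real m powr \<epsilon> * real m
        = (2 powr \<epsilon> - 1) / 48 * c * real m powr (1 + \<epsilon>)"
      using W' by (simp add: powr_add)
    finally have "(2 powr \<epsilon> - 1) / 48 * c * real m powr (1 + \<epsilon>) \<le> real (card F)" .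
    moreover have "1 / 12 * (avg_degree V E / log 2 (2 * real n / avg_degree V E)) \<le> avg_degree W' F"
    proof -
      \<comment> \<open>The average degree is twice the edge density, and \<open>D / (3 * L)\<close>
        is one twelfth of \<open>4 * D / L\<close>.\<close>
      have "1 / 12 * (4 * D / L) \<le> 2 * p" using p by simp
      also have "\<dots> \<le> 2 * real (card F) / real m"
        using WF(3) W' by (simp add: field_simps m_def)
      finally show ?thesis unfolding L_eq using avg avg_degree_eq[OF W'(1)] by (simp add: m_def)
    qed
    moreover have "is_subgraph W' F V E" using WF(1) H(1) by (rule is_subgraph_trans)
    ultimately show ?thesis using WF(2) m_def by blast
  qed
  show ?thesis
  proof (cases "5/2 \<le> L")
    case True
    have "2 powr L = real n / (2 * D)" unfolding L_def using D n by simp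
    then have "D * 2 powr L = real (card V) / 2" using D assms(5) by simp
    moreover have "D = real (card E) / (2 * real (card V))" by (simp add: D_def assms(5))
    ultimately obtain W M k where H: "is_subgraph W M V E" "\<And>v. degree M v \<le> k"
        "real k / 4 * real (card W) \<le> real (card M)" "D / (6 * L) * real (card W) \<le> real (card M)"
        "C * (real (card W) / real n) powr \<epsilon> * real (card W) \<le> real (card M)"
      using exists_dense_union_of_matchings[OF assms(1,2,4) _ D True] unfolding assms(5) C_def by blast
    have "0 < card W" using H(1) by (auto simp: is_subgraph_def simple_graph_def card_gt_0_iff)
    then have *: "real k / 4 \<le> real (card M) / real (card W)" "D / (6 * L) \<le> real (card M) / real (card W)"
        "C * (real (card W) / real n) powr \<epsilon> \<le> real (card M) / real (card W)"
      using H(3-5) by (simp_all only: pos_le_divide_eq of_nat_0_less_iff)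
    \<comment> \<open>Here even the factor 4 holds; the factor 6 is what the case of small
      \<open>L\<close> needs.\<close>
    have "real (degree M v) \<le> 6 * (real (card M) / real (card W))" for v
    proof -
      have "real (degree M v) \<le> real k" using H(2) by simp
      also have "\<dots> \<le> 6 * (real k / 4)" by simp
      also have "\<dots> \<le> 6 * (real (card M) / real (card W))" by (rule mult_left_mono[OF *(1)]) simp
      finally show ?thesis .
    qed
    then show ?thesis using * H(1) by (intro finish[of W M]) auto
  next
    case False
    \<comment> \<open>Now \<open>G\<close> itself serves: as 32 is at most 36,
      \<open>2 powr (5/2)\<close> is at most 6, so all degrees are below \<open>12 * D\<close>, six
      times the edge density \<open>2 * D\<close>.\<close>
    have "real n / (2 * D) = 2 powr L" unfolding L_def using D n by simp
    also have "\<dots> \<le> 6"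
    proof -
      have "2 powr L \<le> 2 powr (5/2)" using False by (intro powr_mono) auto
      moreover have "(2 powr (5/2))\<^sup>2 \<le> (6::real)\<^sup>2"
        by (simp add: power2_eq_square flip: powr_add)
      then have "2 powr (5/2) \<le> (6::real)" by (rule power2_le_imp_le) simp
      ultimately show ?thesis by linarith
    qed
    finally have n_le: "real n \<le> 12 * D" using D by (simp add: field_simps)
    have "is_subgraph V E V E" using assms(4) by (simp add: is_subgraph_def)
    then show ?thesis
    proof (rule finish[where p = "2 * D"])
      show "real (degree E v) \<le> 6 * (2 * D)" if "v \<in> V" for v
        using degree_less_card[OF assms(4) that] n_le assms(5) by simp
      show "2 * D = real (card E) / real (card V)" by (simp add: D_def assms(5))
      have "D / (6 * L) \<le> D / 1" using D L by (intro divide_left_mono) auto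
      then show "D / (6 * L) \<le> 2 * D" using D by simp
      have "(2 powr \<epsilon> - 1) * D \<le> 1 * D" using q D by (intro mult_right_mono) auto
      then show "C * (real (card V) / real n) powr \<epsilon> \<le> 2 * D"
        using n D assms(5) by (simp add: C_def)
    qed
  qed
qed

end
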